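(* Let $F$ be a constant vector field on the torus $\mathbb T^2$ generating an irrational flow (every orbit of which is dense in $\mathbb T^2$), and let $g\colon\mathbb T^2\to\mathbb R$ be a non-negative smooth function with a single zero, at a point $p\in\mathbb T^2$. If $f\colon\mathbb T^2\to\mathbb T^2$ is the time-1 map of the flow generated by the vector field $gF$, then $f$ is sensitive but not first-time sensitive.
   Context: $\mathbb T^2=\mathbb R^2/\mathbb Z^2$ with its usual flat metric $d$; $B(x,r)$ is the open ball. A map $f\colon X\to X$ of a compact metric space is sensitive if there is $\varepsilon>0$ (a sensitivity constant) such that for every $x\in X$ and every $\delta>0$ there exist $y\in X$ with $d(x,y)<\delta$ and $n\in\mathbb N$ with $d(f^n(x),f^n(y))>\varepsilon$. Any $\gamma\in(0,\varepsilon]$ is then also a sensitivity constant. For a sensitive homeomorphism and a sensitivity constant $\gamma$, the first increasing time $n_1(x,r,\gamma)$ is the first iterate $n\ge 0$ with $\operatorname{diam} f^{n}(B(x,r))>\gamma$. A sensitive homeomorphism $f$ with sensitivity constant $\varepsilon$ is first-time sensitive if there is a sequence of functions $r_k\colon X\to(0,\infty)$, $k\in\mathbb N=\{1,2,\dots\}$, with $r_1$ constant and $(r_k(x))_k$ decreasing monotonically to $0$ for each $x$, such that for each $\gamma\in(0,\varepsilon]$ there is $m_\gamma>0$ satisfying (F1) $|n_1(x,r_{k+1}(x),\gamma)-n_1(x,r_k(x),\gamma)|\leq m_\gamma$ and (F2) $|n_1(x,r_k(x),\gamma)-n_1(x,r_k(x),\varepsilon)|\leq m_\gamma$ for every $x\in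 X$ and every $k\in\mathbb N$ with $r_k(x)\leq\gamma$. *)

theory Defs
  imports "HOL-Analysis.Analysis"
begin

section \<open>The flat torus\<close>

definition int_lattice :: "(real ^ 2) set" where
  "int_lattice = {z. \<forall>i. z $ i \<in> \<int>}"

lemma int_lattice_0 [simp]: "0 \<in> int_lattice"
  and int_lattice_add: "x \<in> int_lattice \<Longrightarrow> y \<in> int_lattice \<Longrightarrow> x + y \<in> int_lattice"
  and int_lattice_diff: "x \<in> int_lattice \<Longrightarrow> y \<in> int_lattice \<Longrightarrow> x - y \<in> int_lattice"
  and int_lattice_minus: "x \<in> int_lattice \<Longrightarrow> - x \<in> int_lattice"
  by (auto simp: int_lattice_def)

lemma int_lattice_norm_less_1:
  assumes "z \<in> int_lattice" "norm z < 1"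
  shows "z = 0"
proof -
  have "z $ i = 0" for i
  proof -
    have "\<bar>z $ i\<bar> < 1" using component_le_norm_cart[of z i] assms(2) by linarith
    moreover obtain n where "z $ i = of_int n"
      using assms(1) unfolding int_lattice_def by (auto elim: Ints_cases)
    ultimately show ?thesis by auto
  qed
  thus ?thesis by (simp add: vec_eq_iff)
qed

definition torus_rel :: "real ^ 2 \<Rightarrow> real ^ 2 \<Rightarrow> bool" where
  "torus_rel x y \<longleftrightarrow> x - y \<in> int_lattice"

lemma equivp_torus_rel: "equivp torus_rel"
proof (rule equivpI)
  show "reflp torus_rel" by (simp add: reflp_def torus_rel_def)
  show "symp torus_rel"
    unfolding symp_def torus_rel_def by (metis int_lattice_minus minus_diff_eq)
  show "transp torus_rel"
  proof (rule transpI)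
    fix x y z assume "torus_rel x y" "torus_rel y z"
    hence "(x - y) + (y - z) \<in> int_lattice" unfolding torus_rel_def by (rule int_lattice_add)
    thus "torus_rel x z" by (simp add: torus_rel_def)
  qed
qed

quotient_type torus = "real ^ 2" / torus_rel
  by (rule equivp_torus_rel)

lift_definition torus_proj :: "real ^ 2 \<Rightarrow> torus" is "\<lambda>x. x" .

lemma torus_proj_eq_iff: "torus_proj x = torus_proj y \<longleftrightarrow> x - y \<in> int_lattice"
  by transfer (simp add: torus_rel_def)

lemma torus_proj_cases: obtains y where "x = torus_proj y"
proof -
  have "\<exists>y. x = torus_proj y" by transfer (use equivp_torus_rel in \<open>auto intro: equivp_reflp\<close>)
  thus ?thesis using that by blast
qed

lemma lattice_dist_cong:
  assumes "torus_rel x x'" "torus_rel y y'"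
  shows "(INF z\<in>int_lattice. norm (x - y - z)) = (INF z\<in>int_lattice. norm (x' - y' - z))"
proof -
  define w where "w = (x - x') - (y - y')"
  have w: "w \<in> int_lattice"
    using assms unfolding w_def torus_rel_def by (rule int_lattice_diff)
  have "bij_betw (\<lambda>z. z + w) int_lattice int_lattice"
    by (rule bij_betwI[where g = "\<lambda>z. z - w"]) (use w in \<open>auto intro: int_lattice_add int_lattice_diff\<close>)
  hence "int_lattice = (\<lambda>z. z + w) ` int_lattice" by (simp add: bij_betw_def)
  hence "(\<lambda>z. norm (x - y - z)) ` int_lattice = (\<lambda>z. norm (x - y - z)) ` (\<lambda>z. z + w) ` int_lattice"
    by simp
  also have "\<dots> = (\<lambda>z. norm (x' - y' - z)) ` int_lattice"
    by (auto simp: image_image w_def algebra_simps)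
  finally show ?thesis by simp
qed

instantiation torus :: metric_space
begin

lift_definition dist_torus :: "torus \<Rightarrow> torus \<Rightarrow> real" is
  "\<lambda>x y. INF z\<in>int_lattice. norm (x - y - z)"
  by (rule lattice_dist_cong)

definition uniformity_torus :: "(torus \<times> torus) filter" where
  "uniformity_torus = (INF e\<in>{0<..}. principal {(x, y). dist x y < e})"

definition open_torus :: "torus set \<Rightarrow> bool" where
  "open_torus U \<longleftrightarrow> (\<forall>x\<in>U. eventually (\<lambda>(x', y). x' = x \<longrightarrow> y \<in> U) uniformity)"

instance
proof
  have bdd: "bdd_below ((\<lambda>z. norm (x - y - z)) ` int_lattice)" for x y :: "real ^ 2"
    by (rule bdd_belowI[of _ 0]) auto
  have ne: "int_lattice \<noteq> {}" using int_lattice_0 by blast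
  have approx: "\<exists>z\<in>int_lattice. norm (x - y - z) < e"
    if "(INF z\<in>int_lattice. norm (x - y - z)) < e" for x y :: "real ^ 2" and e
    using that cINF_less_iff[OF ne bdd] by blast
  have lower: "(INF z\<in>int_lattice. norm (x - y - z)) \<le> norm (x - y - z)"
    if "z \<in> int_lattice" for x y z :: "real ^ 2"
    by (rule cINF_lower[OF bdd that])
  have nonneg: "0 \<le> (INF z\<in>int_lattice. norm (x - y - z))" for x y :: "real ^ 2"
    by (rule cINF_greatest[OF ne]) auto
  show "dist x y = 0 \<longleftrightarrow> x = y" for x y :: torus
  proof transfer
    fix x y :: "real ^ 2"
    show "(INF z\<in>int_lattice. norm (x - y - z)) = 0 \<longleftrightarrow> torus_rel x y"
    proof
      assume 0: "(INF z\<in>int_lattice. norm (x - y - z)) = 0"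
      obtain z where z: "z \<in> int_lattice" "norm (x - y - z) < 1/2"
        using approx[of x y "1/2"] 0 by auto
      have "norm (x - y - z) \<le> 0"
      proof (rule field_le_epsilon)
        fix e :: real assume "e > 0"
        then obtain z' where z': "z' \<in> int_lattice" "norm (x - y - z') < min e (1/2)"
          using approx[of x y "min e (1/2)"] 0 by auto
        have "norm (z - z') = norm ((x - y - z') - (x - y - z))" by (simp add: algebra_simps)
        also have "\<dots> < 1" using norm_triangle_ineq4[of "x - y - z'" "x - y - z"] z z' by simp
        finally have "z - z' = 0"
          using int_lattice_norm_less_1 int_lattice_diff z z' by blast
        thus "norm (x - y - z) \<le> 0 + e" using z' by simp
      qed
      thus "torus_rel x y" using z by (simp add: torus_rel_def)
    next
      assume "torus_rel x y"
      hence "(INF z\<in>int_lattice. norm (x - y - z)) \<le> 0"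
        using lower[of "x - y" x y] by (simp add: torus_rel_def)
      thus "(INF z\<in>int_lattice. norm (x - y - z)) = 0" using nonneg[of x y] by linarith
    qed
  qed
  show "dist x y \<le> dist x z + dist y z" for x y z :: torus
  proof transfer
    fix x y z :: "real ^ 2"
    let ?D = "\<lambda>x y. INF z\<in>int_lattice. norm (x - y - z)"
    show "?D x y \<le> ?D x z + ?D y z"
    proof (rule field_le_epsilon)
      fix e :: real assume "e > 0"
      obtain a where a: "a \<in> int_lattice" "norm (x - z - a) < ?D x z + e/2"
        using approx[of x z "?D x z + e/2"] \<open>e > 0\<close> by auto
      obtain b where b: "b \<in> int_lattice" "norm (y - z - b) < ?D y z + e/2"
        using approx[of y z "?D y z + e/2"] \<open>e > 0\<close> by auto
      have "?D x y \<le> norm (x - y - (a - b))" by (intro lower int_lattice_diff a b)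
      also have "\<dots> = norm ((x - z - a) - (y - z - b))" by (simp add: algebra_simps)
      also have "\<dots> \<le> norm (x - z - a) + norm (y - z - b)" by (rule norm_triangle_ineq4)
      finally show "?D x y \<le> ?D x z + ?D y z + e" using a b by simp
    qed
  qed
qed (simp_all add: uniformity_torus_def open_torus_def)

end

lemma dist_torus_proj: "dist (torus_proj x) (torus_proj y) = (INF z\<in>int_lattice. norm (x - y - z))"
  by transfer simp

lemma dist_torus_proj_le: "dist (torus_proj x) (torus_proj y) \<le> dist x y"
proof -
  have "(INF z\<in>int_lattice. norm (x - y - z)) \<le> norm (x - y - 0)"
    by (rule cINF_lower) (auto intro: bdd_belowI[of _ 0])
  thus ?thesis by (simp add: dist_torus_proj dist_norm)
qed

lemma continuous_on_torus_proj: "continuous_on A torus_proj"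
  unfolding continuous_on_iff using dist_torus_proj_le by (meson le_less_trans)

lemma compact_torus: "compact (UNIV :: torus set)"
proof -
  have "x \<in> torus_proj ` cbox 0 1" for x
  proof -
    obtain y where y: "x = torus_proj y" by (rule torus_proj_cases)
    define y' :: "real ^ 2" where "y' = (\<chi> i. frac (y $ i))"
    have "y' \<in> cbox 0 1"
      by (auto simp: mem_box_cart y'_def less_imp_le[OF frac_lt_1])
    moreover have "y - y' \<in> int_lattice"
      by (auto simp: int_lattice_def y'_def frac_def)
    ultimately show ?thesis using y torus_proj_eq_iff by blast
  qed
  hence "UNIV = torus_proj ` cbox 0 1" by auto
  thus ?thesis by (metis compact_cbox compact_continuous_image continuous_on_torus_proj)
qed


section \<open>Smooth functions and flows on the torus\<close>

fun times_differentiable :: "nat \<Rightarrow> (real ^ 2 \<Rightarrow> real) \<Rightarrow> bool" where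
  "times_differentiable 0 h \<longleftrightarrow> continuous_on UNIV h"
| "times_differentiable (Suc k) h \<longleftrightarrow>
     h differentiable_on UNIV \<and>
     (\<forall>v. times_differentiable k (\<lambda>x. frechet_derivative h (at x) v))"

text \<open>The covering projection provides the charts of the torus, so that smoothness of a
  function on the torus is smoothness of its periodic lift to the plane.\<close>

definition smooth_on_torus :: "(torus \<Rightarrow> real) \<Rightarrow> bool" where
  "smooth_on_torus g \<longleftrightarrow> (\<forall>k. times_differentiable k (g \<circ> torus_proj))"

text \<open>Every tangent space of the torus is identified with the plane through the covering
  projection; a vector field on the torus is thus a function \<open>torus \<Rightarrow> real ^ 2\<close>, and the
  velocity of a curve at time \<open>t\<close> is that of a lift of the curve near \<open>t\<close>.\<close>

definition has_velocity :: "(real \<Rightarrow> torus) \<Rightarrow> real ^ 2 \<Rightarrow> real \<Rightarrow> bool" where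
  "has_velocity c v t \<longleftrightarrow>
     (\<exists>u. (\<forall>\<^sub>F s in nhds t. torus_proj (u s) = c s) \<and> (u has_vector_derivative v) (at t))"

definition is_flow :: "(real \<Rightarrow> 'a :: metric_space \<Rightarrow> 'a) \<Rightarrow> bool" where
  "is_flow \<phi> \<longleftrightarrow>
     continuous_on UNIV (\<lambda>(t, x). \<phi> t x) \<and>
     (\<forall>x. \<phi> 0 x = x) \<and>
     (\<forall>s t x. \<phi> (s + t) x = \<phi> s (\<phi> t x))"

definition flow_generated_by :: "(torus \<Rightarrow> real ^ 2) \<Rightarrow> (real \<Rightarrow> torus \<Rightarrow> torus) \<Rightarrow> bool" where
  "flow_generated_by X \<phi> \<longleftrightarrow>
     is_flow \<phi> \<and> (\<forall>x t. has_velocity (\<lambda>s. \<phi> s x) (X (\<phi> t x)) t)"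

definition irrational_slope :: "real ^ 2 \<Rightarrow> bool" where
  "irrational_slope v \<longleftrightarrow> v $ 1 \<noteq> 0 \<and> v $ 2 / v $ 1 \<notin> \<rat>"

lemma dist_torus_proj_translate:
  "dist (torus_proj (x + w)) (torus_proj (y + w)) = dist (torus_proj x) (torus_proj y)"
  by (simp add: dist_torus_proj)

lemma flow_of_constant_field:
  assumes "flow_generated_by (\<lambda>_. v) \<phi>"
  shows "\<phi> t (torus_proj a) = torus_proj (a + t *\<^sub>R v)"
proof -
  define h where "h s = dist (\<phi> s (torus_proj a)) (torus_proj (a + s *\<^sub>R v))" for s
  have "(h has_real_derivative 0) (at t)" for t
  proof -
    obtain u where u: "\<forall>\<^sub>F s in nhds t. torus_proj (u s) = \<phi> s (torus_proj a)"
        "(u has_vector_derivative v) (at t)"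
      using assms unfolding flow_generated_by_def has_velocity_def by blast
    have ut: "torus_proj (u t) = \<phi> t (torus_proj a)" using u(1) by (rule eventually_nhds_x_imp_x)
    have bound: "\<bar>h s - h t\<bar> \<le> norm (u s - u t - (s - t) *\<^sub>R v)"
      if s: "torus_proj (u s) = \<phi> s (torus_proj a)" for s
    proof -
      let ?q = "torus_proj (u t + (s - t) *\<^sub>R v)"
      have "h t = dist ?q (torus_proj (a + t *\<^sub>R v + (s - t) *\<^sub>R v))"
        unfolding h_def dist_torus_proj_translate ut ..
      also have "a + t *\<^sub>R v + (s - t) *\<^sub>R v = a + s *\<^sub>R v" by (simp add: algebra_simps)
      finally have "\<bar>h s - h t\<bar> \<le> dist (torus_proj (u s)) ?q"
        unfolding h_def s using dist_triangle[of "\<phi> s (torus_proj a)" "torus_proj (a + s *\<^sub>R v)" ?q]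
          dist_triangle[of ?q "torus_proj (a + s *\<^sub>R v)" "\<phi> s (torus_proj a)"]
        by (simp add: dist_commute)
      also have "\<dots> \<le> dist (u s) (u t + (s - t) *\<^sub>R v)" by (rule dist_torus_proj_le)
      finally show ?thesis by (simp add: dist_norm algebra_simps)
    qed
    have lim: "((\<lambda>s. norm (u s - u t - (s - t) *\<^sub>R v) / norm (s - t)) \<longlongrightarrow> 0) (at t)"
      using u(2) unfolding has_vector_derivative_def has_derivative_iff_norm by blast
    have "((\<lambda>s. (h s - h t) / (s - t)) \<longlongrightarrow> 0) (at t)"
    proof (rule Lim_null_comparison[OF _ lim])
      have "\<forall>\<^sub>F s in at t. torus_proj (u s) = \<phi> s (torus_proj a)"
        using u(1) by (simp add: eventually_nhds_conv_at)
      thus "\<forall>\<^sub>F s in at t. norm ((h s - h t) / (s - t))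
              \<le> norm (u s - u t - (s - t) *\<^sub>R v) / norm (s - t)"
        by eventually_elim (use bound in \<open>auto intro: divide_right_mono\<close>)
    qed
    thus ?thesis by (simp add: has_field_derivative_iff)
  qed
  hence "h t = h 0" by (intro DERIV_isconst_all) auto
  also have "h 0 = 0"
    using assms by (simp add: h_def flow_generated_by_def is_flow_def)
  finally show ?thesis by (simp add: h_def)
qed

lemma irrational_flow_orbit_dense:
  assumes "irrational_slope v" "flow_generated_by (\<lambda>_. v) \<phi>"
  shows "closure (range (\<lambda>t. \<phi> t x)) = UNIV"
proof -
  have v1: "v $ 1 \<noteq> 0" and irr: "v $ 2 / v $ 1 \<notin> \<rat>"
    using assms(1) by (auto simp: irrational_slope_def)
  obtain a where a: "x = torus_proj a" by (rule torus_proj_cases)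
  have "\<exists>t. dist (\<phi> t x) y < e" if "e > 0" for y e
  proof -
    obtain b where b: "y = torus_proj b" by (rule torus_proj_cases)
    define w where "w = b - a"
    obtain k :: int and h :: int where kh:
      "\<bar>of_int k * (v $ 2 / v $ 1) - of_int h - (w $ 2 - w $ 1 * (v $ 2 / v $ 1))\<bar> < e"
      using sequence_of_fractional_parts_is_dense[OF irr \<open>e > 0\<close>] by metis
    define t where "t = (w $ 1 + of_int k) / v $ 1"
    define z :: "real ^ 2" where "z = vector [of_int k, of_int h]"
    define d where "d = a + t *\<^sub>R v - z"
    have "d - b = (\<chi> i. if i = 1 then 0 else
        of_int k * (v $ 2 / v $ 1) - of_int h - (w $ 2 - w $ 1 * (v $ 2 / v $ 1)))"
      using v1 by (simp add: vec_eq_iff forall_2 d_def t_def z_def w_def field_simps)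
    hence "norm (d - b) < e"
      using kh norm_le_l1_cart[of "d - b"] by (simp add: sum_2)
    moreover have "\<phi> t x = torus_proj d"
      unfolding a flow_of_constant_field[OF assms(2)] torus_proj_eq_iff
      by (simp add: d_def z_def int_lattice_def forall_2)
    ultimately have "dist (\<phi> t x) y < e"
      unfolding b using dist_torus_proj_le[of d b] by (simp add: dist_norm)
    thus ?thesis by blast
  qed
  thus ?thesis by (auto simp: closure_approachable)
qed

lemma is_flow_homeomorphism:
  assumes "is_flow \<phi>"
  shows "homeomorphism UNIV UNIV (\<phi> t) (\<phi> (- t))"
proof -
  have cont: "continuous_on UNIV (\<phi> s)" for s
  proof -
    have "continuous_on UNIV ((\<lambda>(t, x). \<phi> t x) \<circ> Pair s)"
      using assms unfolding is_flow_def
      by (intro continuous_on_compose) (auto intro!: continuous_intros intro: continuous_on_subset)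
    thus ?thesis by (simp add: o_def)
  qed
  have inv: "\<phi> (- s) (\<phi> s x) = x" for s x
    using assms unfolding is_flow_def by (metis ab_left_minus)
  show ?thesis
    using cont inv[of t] inv[of "- t"] by (intro homeomorphismI) auto
qed


section \<open>First-time sensitivity\<close>

text \<open>The ambient space is meant to be compact, so that \<open>diameter\<close> is the supremum of the
  distances. Iterates in the definition of sensitivity and the indices of the radii \<open>r k\<close>
  range over \<open>{1, 2, \<dots>}\<close> (\<open>r 0\<close> is irrelevant), whereas the first increasing time may be 0;
  it exists for every sensitivity constant. The sequence of radii decreases weakly.\<close>

definition sensitivity_constant :: "('a :: metric_space \<Rightarrow> 'a) \<Rightarrow> real \<Rightarrow> bool" where
  "sensitivity_constant f \<epsilon> \<longleftrightarrow>
     \<epsilon> > 0 \<and>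
     (\<forall>x. \<forall>\<delta>>0. \<exists>y. dist x y < \<delta> \<and> (\<exists>n\<ge>1. dist ((f ^^ n) x) ((f ^^ n) y) > \<epsilon>))"

definition sensitive :: "('a :: metric_space \<Rightarrow> 'a) \<Rightarrow> bool" where
  "sensitive f \<longleftrightarrow> (\<exists>\<epsilon>. sensitivity_constant f \<epsilon>)"

definition first_increasing_time ::
    "('a :: metric_space \<Rightarrow> 'a) \<Rightarrow> 'a \<Rightarrow> real \<Rightarrow> real \<Rightarrow> nat" where
  "first_increasing_time f x r \<gamma> = (LEAST n. diameter ((f ^^ n) ` ball x r) > \<gamma>)"

definition first_time_sensitive :: "('a :: metric_space \<Rightarrow> 'a) \<Rightarrow> bool" where
  "first_time_sensitive f \<longleftrightarrow>
     (\<exists>f'. homeomorphism UNIV UNIV f f') \<and>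
     (\<exists>\<epsilon>. sensitivity_constant f \<epsilon> \<and>
       (\<exists>r :: nat \<Rightarrow> 'a \<Rightarrow> real.
          (\<forall>k\<ge>1. \<forall>x. r k x > 0) \<and>
          (\<exists>c. \<forall>x. r 1 x = c) \<and>
          (\<forall>x. \<forall>k\<ge>1. r (Suc k) x \<le> r k x) \<and>
          (\<forall>x. (\<lambda>k. r k x) \<longlonglongrightarrow> 0) \<and>
          (\<forall>\<gamma>. 0 < \<gamma> \<and> \<gamma> \<le> \<epsilon> \<longrightarrow>
             (\<exists>m>0. \<forall>x. \<forall>k\<ge>1. r k x \<le> \<gamma> \<longrightarrow>
                \<bar>real (first_increasing_time f x (r (Suc k) x) \<gamma>)
                   - real (first_increasing_time f x (r k x) \<gamma>)\<bar> \<le> m \<and>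
                \<bar>real (first_increasing_time f x (r k x) \<gamma>)
                   - real (first_increasing_time f x (r k x) \<epsilon>)\<bar> \<le> m))))"

end

theory Submission
  imports Defs
begin

text \<open>
  The flow \<open>\<phi>\<close> moves every point along its line of direction \<open>F\<close>, so
  \<open>\<phi> t (torus_proj a) = torus_proj (a + D t *\<^sub>R F)\<close>, where the displacement \<open>D\<close> is the integral
  of \<open>g\<close> along the orbit and never decreases. Forward orbits are thus of two kinds. If \<open>D\<close> stays
  bounded, it converges, the speed tends to zero, and the orbit converges to \<open>p\<close>. If \<open>D\<close> tends to
  infinity, the orbit traverses a whole half-line and has to leave a fixed neighbourhood of \<open>p\<close>
  again and again, even at integer times.

  Sensitivity follows because both kinds are dense. The points \<open>p - s F\<close> with \<open>s > 0\<close> can never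
  pass \<open>p\<close>, so their orbits converge to \<open>p\<close>; the points \<open>p + s F\<close> with \<open>s > 0\<close> never
  meet \<open>p\<close>, since an irrational line does not close up, so their orbits run away. Each of these
  half-lines is dense in the torus. Hence next to every point there is one of the other kind, and
  the two orbits are infinitely often a definite distance apart. That \<open>p\<close> cannot be reached in
  finite time is where smoothness enters: \<open>g\<close> is differentiable, so its decay at \<open>p\<close> is at least
  linear along the line.

  First-time sensitivity fails because distances grow only by shear, which is extremely slow at
  the scale of tiny balls. Suppose that \<open>\<phi> 1\<close> is first-time sensitive with constant \<open>\<epsilon>\<close>. Conditions
  (F1) and (F2) together say that for each \<open>\<gamma> \<le> \<epsilon>\<close> there is a number \<open>M\<close> such that, for every
  \<open>x\<close> and every late time \<open>a\<close>, some tiny ball around \<open>x\<close> has an image of diameter at most \<open>\<gamma>\<close>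
  at time \<open>a\<close> and one of diameter more than \<open>\<epsilon>\<close> at most \<open>M\<close> steps later
  (\<open>first_time_sensitive_late_stretching\<close>). Take \<open>x\<close> that runs away, and late times \<open>a\<close> at which its orbit
  is near some \<open>q \<noteq> p\<close>. All points of a tiny ball stay on lines that are tiny distances apart, so
  its image at time \<open>a\<close> is almost contained in the segment of length \<open>2 \<gamma>\<close> on either side of \<open>q\<close>
  along its line. The speed is positive at \<open>q\<close>, so for small \<open>\<gamma>\<close> this segment is an orbit arc
  \<open>{\<phi> \<tau> q | \<bar>\<tau>\<bar> \<le> \<tau>0}\<close> with \<open>\<tau>0\<close> small, where \<open>\<gamma>\<close> depends only on \<open>q\<close> and \<open>\<epsilon>\<close>. An arc that takes
  time \<open>\<tau>0\<close> remains one, and so remains short, forever; by continuity the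
  image of the ball remains short for \<open>M\<close> more steps once the ball is small enough
  (\<open>no_stretching_away_from_zero\<close>), a contradiction.
\<close>

section \<open>The torus and its lines of irrational slope\<close>

lemma torus_near_lift:
  assumes "dist (torus_proj x) y < e"
  obtains w where "norm w < e" "y = torus_proj (x + w)"
proof -
  obtain b where b: "y = torus_proj b" by (rule torus_proj_cases)
  have ne: "int_lattice \<noteq> {}" using int_lattice_0 by blast
  have bdd: "bdd_below ((\<lambda>z. norm (x - b - z)) ` int_lattice)"
    by (rule bdd_belowI[of _ 0]) auto
  obtain z where z: "z \<in> int_lattice" "norm (x - b - z) < e"
    using assms unfolding b dist_torus_proj cINF_less_iff[OF ne bdd] by blast
  show ?thesis
  proof
    show "norm (- (x - b - z)) < e" using z by (simp only: norm_minus_cancel)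
    show "y = torus_proj (x + - (x - b - z))"
      unfolding b torus_proj_eq_iff using z by (simp add: int_lattice_minus)
  qed
qed

lemma continuous_on_torus:
  fixes h :: "torus \<Rightarrow> 'a :: metric_space"
  assumes "continuous_on UNIV (h \<circ> torus_proj)"
  shows "continuous_on UNIV h"
  unfolding continuous_on_iff
proof (intro ballI allI impI)
  fix x :: torus and e :: real assume "e > 0"
  obtain a where a: "x = torus_proj a" by (rule torus_proj_cases)
  obtain d where d: "d > 0" "\<And>b. dist b a < d \<Longrightarrow> dist (h (torus_proj b)) (h (torus_proj a)) < e"
    using assms \<open>e > 0\<close> unfolding continuous_on_iff by (metis UNIV_I comp_apply)
  have "dist (h y) (h x) < e" if y: "dist y x < d" for y
  proof -
    obtain w where "norm w < d" "y = torus_proj (a + w)"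
      using y unfolding a by (metis dist_commute torus_near_lift)
    thus ?thesis using d(2)[of "a + w"] by (simp add: a dist_norm)
  qed
  thus "\<exists>d>0. \<forall>x'\<in>UNIV. dist x' x < d \<longrightarrow> dist (h x') (h x) < e" using \<open>d > 0\<close> by blast
qed

text \<open>The points within \<open>c \<le> 1/4\<close> of the lattice form disjoint disks, and a connected set that
  contains \<open>0\<close> stays in the disk around \<open>0\<close>. In this way a bound on distances in the torus becomes
  a bound on norms in the plane.\<close>

lemma norm_less_of_connected_lift:
  assumes "connected S" "0 \<in> S" "c \<le> 1/4" "a \<in> S"
    and close: "\<And>b. b \<in> S \<Longrightarrow> dist (torus_proj b) (torus_proj 0) < c"
  shows "norm a < c"
proof -
  have alt: "norm b < c \<or> norm b > 1/2" if "b \<in> S" for b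
  proof -
    have "dist (torus_proj 0) (torus_proj b) < c" using close[OF that] by (simp add: dist_commute)
    then obtain w where w: "norm w < c" "torus_proj b = torus_proj (0 + w)"
      using torus_near_lift by blast
    show ?thesis
    proof (cases "norm (b - w) < 1")
      case True
      thus ?thesis using w int_lattice_norm_less_1[of "b - w"] by (simp add: torus_proj_eq_iff)
    next
      case False
      thus ?thesis using w norm_triangle_ineq4[of b w] \<open>c \<le> 1/4\<close> by linarith
    qed
  qed
  have "\<not> norm a > 1/2"
  proof
    assume "norm a > 1/2"
    have "connected (norm ` S)" by (intro connected_continuous_image continuous_intros assms)
    moreover have "0 \<in> norm ` S" using assms(2) by force
    ultimately have "1/2 \<in> norm ` S"
      using connectedD_interval[of "norm ` S" 0 "norm a" "1/2"] \<open>norm a > 1/2\<close> \<open>a \<in> S\<close> by auto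
    thus False using alt \<open>c \<le> 1/4\<close> by fastforce
  qed
  thus ?thesis using alt \<open>a \<in> S\<close> by blast
qed

lemma irrational_line_no_return:
  assumes "irrational_slope v" "t *\<^sub>R v \<in> int_lattice"
  shows "t = 0"
proof (rule ccontr)
  assume "t \<noteq> 0"
  have "(t * v $ 2) / (t * v $ 1) \<in> \<rat>"
    using assms(2) by (intro Rats_divide) (auto simp: int_lattice_def intro: Ints_subset_Rats[THEN subsetD])
  thus False using assms(1) \<open>t \<noteq> 0\<close> by (simp add: irrational_slope_def)
qed

text \<open>Recurrence: by compactness, two of the equally spaced points on the line are close, and
  translation moves the earlier one to the starting point. It turns the density of a whole line
  into that of each of its halves.\<close>

lemma line_returns:
  fixes v :: "real ^ 2"
  assumes "e > 0" "M > 0"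
  obtains T where "T \<ge> M" "dist (torus_proj (a + T *\<^sub>R v)) (torus_proj a) < e"
proof -
  define X where "X n = torus_proj ((real n * M) *\<^sub>R v)" for n
  obtain l r where "strict_mono r" "(X \<circ> r) \<longlonglongrightarrow> l"
    using compact_torus unfolding compact_def by (metis UNIV_I)
  hence "Cauchy (X \<circ> r)" by (blast intro: LIMSEQ_imp_Cauchy)
  then obtain N where "dist (X (r (Suc N))) (X (r N)) < e"
    using \<open>e > 0\<close> unfolding Cauchy_def by (metis comp_apply le_SucI order_refl)
  moreover define k where "k = r (Suc N) - r N"
  have "r N < r (Suc N)" using \<open>strict_mono r\<close> by (simp add: strict_mono_def)
  ultimately have k: "k \<ge> 1" "r (Suc N) = r N + k" "dist (X (r N + k)) (X (r N)) < e"
    unfolding k_def by auto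
  show ?thesis
  proof
    show "real k * M \<ge> M" using k(1) \<open>M > 0\<close> by simp
    let ?w = "a - (real (r N) * M) *\<^sub>R v"
    have "dist (torus_proj ((real (r N + k) * M) *\<^sub>R v + ?w)) (torus_proj ((real (r N) * M) *\<^sub>R v + ?w)) < e"
      using k(3) unfolding dist_torus_proj_translate X_def .
    thus "dist (torus_proj (a + (real k * M) *\<^sub>R v)) (torus_proj a) < e"
      by (simp add: algebra_simps)
  qed
qed

lemma irrational_half_line_dense:
  assumes "irrational_slope v" "e > 0"
  obtains t where "t > 0" "dist (torus_proj (a + t *\<^sub>R v)) y < e"
proof -
  have v1: "v $ 1 \<noteq> 0" and irr: "v $ 2 / v $ 1 \<notin> \<rat>"
    using assms(1) by (auto simp: irrational_slope_def)
  obtain b where b: "y = torus_proj b" by (rule torus_proj_cases)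
  define w where "w = b - a"
  obtain k :: int and h :: int where kh:
    "\<bar>of_int k * (v $ 2 / v $ 1) - of_int h - (w $ 2 - w $ 1 * (v $ 2 / v $ 1))\<bar> < e / 2"
    using sequence_of_fractional_parts_is_dense[OF irr, of "e / 2"] \<open>e > 0\<close>
    by (metis half_gt_zero)
  define t where "t = (w $ 1 + of_int k) / v $ 1"
  define z :: "real ^ 2" where "z = vector [of_int k, of_int h]"
  define d where "d = a + t *\<^sub>R v - z"
  have "d - b = (\<chi> i. if i = 1 then 0 else
      of_int k * (v $ 2 / v $ 1) - of_int h - (w $ 2 - w $ 1 * (v $ 2 / v $ 1)))"
    using v1 by (simp add: vec_eq_iff forall_2 d_def t_def z_def w_def field_simps)
  hence "norm (d - b) < e / 2"
    using kh norm_le_l1_cart[of "d - b"] by (simp add: sum_2)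
  moreover have "torus_proj (a + t *\<^sub>R v) = torus_proj d"
    unfolding torus_proj_eq_iff by (simp add: d_def z_def int_lattice_def forall_2)
  ultimately have near: "dist (torus_proj (a + t *\<^sub>R v)) y < e / 2"
    unfolding b using dist_torus_proj_le[of d b] by (simp add: dist_norm)
  \<comment> \<open>The parameter \<open>t\<close> may be negative; a long near-return makes it positive.\<close>
  obtain T where T: "T \<ge> \<bar>t\<bar> + 1"
      "dist (torus_proj (a + t *\<^sub>R v + T *\<^sub>R v)) (torus_proj (a + t *\<^sub>R v)) < e / 2"
    using line_returns[of "e / 2" "\<bar>t\<bar> + 1"] \<open>e > 0\<close> by (metis abs_ge_zero add_nonneg_pos half_gt_zero zero_less_one)
  show ?thesis
  proof
    show "t + T > 0" using T(1) by linarith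
    show "dist (torus_proj (a + (t + T) *\<^sub>R v)) y < e"
      using near T(2) dist_triangle_half_r[of "torus_proj (a + t *\<^sub>R v)"]
      by (metis add.assoc dist_commute dist_triangle_half_l scaleR_left_distrib)
  qed
qed

section \<open>First-time sensitivity and late images of small balls\<close>

lemma diameter_leI:
  fixes S :: "'a :: metric_space set"
  assumes "\<And>x y. x \<in> S \<Longrightarrow> y \<in> S \<Longrightarrow> dist x y \<le> d" "0 \<le> d"
  shows "diameter S \<le> d"
  unfolding diameter_def using assms by (auto intro!: cSUP_least)

text \<open>Hence the first increasing times of balls around a point tend to infinity as the radii tend
  to zero.\<close>

lemma diameter_image_tendsto_0:
  fixes f :: "'a :: metric_space \<Rightarrow> 'b :: metric_space"
  assumes "isCont f x" "e > 0"
  obtains d where "d > 0" "\<And>r. r \<le> d \<Longrightarrow> diameter (f ` ball x r) \<le> e"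
proof -
  obtain d where d: "d > 0" "\<And>y. dist y x < d \<Longrightarrow> dist (f y) (f x) < e / 2"
    using assms unfolding continuous_at_eps_delta by (metis half_gt_zero)
  show ?thesis
  proof (rule that[OF \<open>d > 0\<close>])
    fix r assume "r \<le> d"
    hence near: "dist (f y) (f x) < e / 2" if "y \<in> ball x r" for y
      using d(2)[of y] that by (simp add: dist_commute)
    show "diameter (f ` ball x r) \<le> e"
    proof (rule diameter_leI)
      fix u v assume "u \<in> f ` ball x r" "v \<in> f ` ball x r"
      thus "dist u v \<le> e" using near by (metis (no_types, lifting) dist_triangle_half_l imageE less_imp_le)
    qed (use \<open>e > 0\<close> in simp)
  qed
qed

text \<open>This is the only consequence of first-time sensitivity that the argument uses. The first
  increasing times at level \<open>\<gamma>\<close> of the balls of radii \<open>r k x\<close> tend to infinity with gaps at most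
  \<open>m\<close>, so for each late \<open>a\<close> one of them lies in \<open>{a<..a + m}\<close>; the one at level \<open>\<epsilon>\<close> comes at
  most \<open>m\<close> later. The threshold \<open>A\<close> has to depend on \<open>x\<close>, because the conditions say nothing
  about radii larger than \<open>\<gamma>\<close>.\<close>

lemma first_time_sensitive_late_stretching:
  fixes f :: "'a :: metric_space \<Rightarrow> 'a"
  assumes "compact (UNIV :: 'a set)" "first_time_sensitive f"
  obtains \<epsilon> where "\<epsilon> > 0"
    "\<And>\<gamma>. 0 < \<gamma> \<Longrightarrow> \<gamma> \<le> \<epsilon> \<Longrightarrow> \<exists>M. \<forall>x. \<forall>\<eta>>0. \<exists>A. \<forall>a\<ge>A. \<exists>r<\<eta>.
       diameter ((f ^^ a) ` ball x r) \<le> \<gamma> \<and> (\<exists>i\<le>M. diameter ((f ^^ (a + i)) ` ball x r) > \<epsilon>)"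
proof -
  obtain f' \<epsilon> r where hom: "homeomorphism UNIV UNIV f f'" and sens: "sensitivity_constant f \<epsilon>"
    and r: "\<And>k x. k \<ge> 1 \<Longrightarrow> r k x > 0" "\<And>x. (\<lambda>k. r k x) \<longlonglongrightarrow> 0"
    and times: "\<And>\<gamma>. 0 < \<gamma> \<Longrightarrow> \<gamma> \<le> \<epsilon> \<Longrightarrow> \<exists>m>0. \<forall>x. \<forall>k\<ge>1. r k x \<le> \<gamma> \<longrightarrow>
                \<bar>real (first_increasing_time f x (r (Suc k) x) \<gamma>)
                   - real (first_increasing_time f x (r k x) \<gamma>)\<bar> \<le> m \<and>
                \<bar>real (first_increasing_time f x (r k x) \<gamma>)
                   - real (first_increasing_time f x (r k x) \<epsilon>)\<bar> \<le> m"
    using assms(2) unfolding first_time_sensitive_def by metis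
  have "\<epsilon> > 0" using sens by (simp add: sensitivity_constant_def)
  have bounded: "bounded S" for S :: "'a set"
    using compact_imp_bounded[OF assms(1)] bounded_subset by blast
  have cont: "isCont (f ^^ n) x" for n x
  proof -
    have "continuous_on UNIV f" using hom by (simp add: homeomorphism_def)
    hence "continuous_on UNIV (f ^^ n)"
      by (induction n) (auto intro: continuous_on_compose2 simp: o_def)
    thus ?thesis by (simp add: continuous_on_eq_continuous_at)
  qed
  have ex: "\<exists>n. diameter ((f ^^ n) ` ball x \<rho>) > \<gamma>" if "\<rho> > 0" "\<gamma> \<le> \<epsilon>" for x \<rho> \<gamma>
  proof -
    obtain y n where yn: "dist x y < \<rho>" "dist ((f ^^ n) x) ((f ^^ n) y) > \<epsilon>"
      using sens \<open>\<rho> > 0\<close> unfolding sensitivity_constant_def by blast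
    have "dist ((f ^^ n) x) ((f ^^ n) y) \<le> diameter ((f ^^ n) ` ball x \<rho>)"
      using yn(1) \<open>\<rho> > 0\<close> by (intro diameter_bounded_bound bounded) auto
    thus ?thesis using yn(2) \<open>\<gamma> \<le> \<epsilon>\<close> by (intro exI[of _ n]) linarith
  qed
  show ?thesis
  proof (rule that[OF \<open>\<epsilon> > 0\<close>])
    fix \<gamma> :: real assume \<gamma>: "0 < \<gamma>" "\<gamma> \<le> \<epsilon>"
    obtain m where "m > 0" and m: "\<And>x k. k \<ge> 1 \<Longrightarrow> r k x \<le> \<gamma> \<Longrightarrow>
                \<bar>real (first_increasing_time f x (r (Suc k) x) \<gamma>)
                   - real (first_increasing_time f x (r k x) \<gamma>)\<bar> \<le> m \<and>
                \<bar>real (first_increasing_time f x (r k x) \<gamma>)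
                   - real (first_increasing_time f x (r k x) \<epsilon>)\<bar> \<le> m"
      using times[OF \<gamma>] by blast
    have "\<exists>A. \<forall>a\<ge>A. \<exists>\<rho><\<eta>. diameter ((f ^^ a) ` ball x \<rho>) \<le> \<gamma> \<and>
        (\<exists>i\<le>nat \<lceil>2 * m\<rceil>. diameter ((f ^^ (a + i)) ` ball x \<rho>) > \<epsilon>)" if "\<eta> > 0" for x \<eta>
    proof -
      define N where "N k = first_increasing_time f x (r k x) \<gamma>" for k
      have before: "diameter ((f ^^ n) ` ball x (r k x)) \<le> \<gamma>" if "n < N k" for n k
        using not_less_Least[of n "\<lambda>n. diameter ((f ^^ n) ` ball x (r k x)) > \<gamma>"] that
        unfolding N_def first_increasing_time_def by simp
      have at_N: "diameter ((f ^^ N k) ` ball x (r k x)) > \<gamma>" if "k \<ge> 1" for k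
        unfolding N_def first_increasing_time_def using ex[OF r(1)[OF that] \<gamma>(2)] by (rule LeastI_ex)
      obtain K where K: "K \<ge> 1" "\<And>k. k \<ge> K \<Longrightarrow> r k x < min \<gamma> \<eta>"
      proof -
        have "\<forall>\<^sub>F k in sequentially. r k x < min \<gamma> \<eta>"
          using r(2) \<gamma>(1) \<open>\<eta> > 0\<close> by (intro order_tendstoD(2)[OF r(2)]) auto
        then obtain K where "\<And>k. k \<ge> K \<Longrightarrow> r k x < min \<gamma> \<eta>"
          unfolding eventually_sequentially by blast
        thus ?thesis using that[of "max 1 K"] by auto
      qed
      have N_unbounded: "\<exists>k\<ge>K. N k > a" for a
      proof -
        have small: "\<forall>\<^sub>F k in sequentially. diameter ((f ^^ n) ` ball x (r k x)) \<le> \<gamma>" for n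
        proof -
          obtain d where d: "d > 0" "\<And>r. r \<le> d \<Longrightarrow> diameter ((f ^^ n) ` ball x r) \<le> \<gamma>"
            using diameter_image_tendsto_0[OF cont \<gamma>(1)] by metis
          show ?thesis
            using order_tendstoD(2)[OF r(2)[of x] d(1)] by eventually_elim (use d(2) in auto)
        qed
        have "\<forall>\<^sub>F k in sequentially. \<forall>n\<in>{..a}. diameter ((f ^^ n) ` ball x (r k x)) \<le> \<gamma>"
          using small by (intro eventually_ball_finite) auto
        hence "\<forall>\<^sub>F k in sequentially. k \<ge> K \<and> (\<forall>n\<in>{..a}. diameter ((f ^^ n) ` ball x (r k x)) \<le> \<gamma>)"
          using eventually_ge_at_top by eventually_elim auto
        then obtain k where k: "k \<ge> K" "\<forall>n\<in>{..a}. diameter ((f ^^ n) ` ball x (r k x)) \<le> \<gamma>"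
          by (metis (mono_tags, lifting) eventually_happens sequentially_bot)
        have "\<not> N k \<le> a" using k at_N[of k] K(1) by force
        thus ?thesis using k(1) by force
      qed
      show ?thesis
      proof (intro exI[of _ "N K"] allI impI)
        fix a assume a: "a \<ge> N K"
        \<comment> \<open>The first ball whose time exceeds \<open>a\<close>; the time of the ball before it is at most \<open>a\<close>.\<close>
        define k where "k = (LEAST k. k \<ge> K \<and> N k > a)"
        have k: "k \<ge> K" "N k > a" using LeastI_ex[OF N_unbounded[of a, unfolded Bex_def]]
          unfolding k_def by auto
        have "k \<noteq> K" using k(2) a by auto
        then obtain j where j: "k = Suc j" "j \<ge> K" using k(1) by (metis le_SucE not0_implies_Suc le_zero_eq nat_neq_iff)
        have "N j \<le> a" using not_less_Least[of j "\<lambda>k. k \<ge> K \<and> N k > a"] j unfolding k_def by force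
        moreover have "\<bar>real (N k) - real (N j)\<bar> \<le> m"
          using m[of j x] j K unfolding N_def by force
        ultimately have Nk: "real (N k) \<le> a + m" by linarith
        define n where "n = first_increasing_time f x (r k x) \<epsilon>"
        have kk: "k \<ge> 1" "r k x < \<gamma>" "r k x < \<eta>" using K k(1) by auto
        have n: "diameter ((f ^^ n) ` ball x (r k x)) > \<epsilon>"
          unfolding n_def first_increasing_time_def using ex[OF r(1)[OF kk(1)] order_refl] by (rule LeastI_ex)
        have "n \<ge> N k" using n before[of n k] \<gamma>(2) by force
        moreover have "\<bar>real (N k) - real n\<bar> \<le> m"
          using m[of k x] kk unfolding N_def n_def by force
        ultimately have "a \<le> n" "real n - real a \<le> 2 * m" using Nk k(2) by linarith+
        hence "n - a \<le> nat \<lceil>2 * m\<rceil>" by linarith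
        thus "\<exists>\<rho><\<eta>. diameter ((f ^^ a) ` ball x \<rho>) \<le> \<gamma> \<and>
            (\<exists>i\<le>nat \<lceil>2 * m\<rceil>. diameter ((f ^^ (a + i)) ` ball x \<rho>) > \<epsilon>)"
          using kk(3) before[OF k(2)] n \<open>a \<le> n\<close>
          by (intro exI[of _ "r k x"] conjI) (auto intro!: exI[of _ "n - a"])
      qed
    qed
    thus "\<exists>M. \<forall>x. \<forall>\<eta>>0. \<exists>A. \<forall>a\<ge>A. \<exists>r<\<eta>.
       diameter ((f ^^ a) ` ball x r) \<le> \<gamma> \<and> (\<exists>i\<le>M. diameter ((f ^^ (a + i)) ` ball x r) > \<epsilon>)"
      by blast
  qed
qed

section \<open>The slowed-down flow\<close>

locale slowed_irrational_flow =
  fixes F :: "real ^ 2" and g :: "torus \<Rightarrow> real" and p :: torus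
    and \<phi> :: "real \<Rightarrow> torus \<Rightarrow> torus"
  assumes irrational: "irrational_slope F"
    and smooth: "smooth_on_torus g"
    and g_nonneg: "g x \<ge> 0"
    and g_zero_iff: "g x = 0 \<longleftrightarrow> x = p"
    and flow: "flow_generated_by (\<lambda>x. g x *\<^sub>R F) \<phi>"
begin

lemma flow_0 [simp]: "\<phi> 0 x = x"
  and flow_add: "\<phi> (s + t) x = \<phi> s (\<phi> t x)"
  and continuous_flow: "continuous_on UNIV (\<lambda>(t, x). \<phi> t x)"
  using flow by (auto simp: flow_generated_by_def is_flow_def)

lemma flow_commute: "\<phi> s (\<phi> t x) = \<phi> t (\<phi> s x)"
  by (metis add.commute flow_add)

lemma continuous_on_flow [continuous_intros]:
  assumes "continuous_on A s" "continuous_on A y"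
  shows "continuous_on A (\<lambda>z. \<phi> (s z) (y z))"
  using continuous_on_compose2[OF continuous_flow, of A "\<lambda>z. (s z, y z)"] assms
  by (auto intro: continuous_intros)

lemma flow_uniformly_continuous:
  assumes "e > 0"
  obtains d where "d > 0"
    "\<And>s t x y. \<bar>s\<bar> \<le> M \<Longrightarrow> \<bar>t\<bar> \<le> M \<Longrightarrow> \<bar>s - t\<bar> < d \<Longrightarrow> dist x y < d \<Longrightarrow> dist (\<phi> s x) (\<phi> t y) < e"
proof -
  let ?K = "{-M..M} \<times> (UNIV :: torus set)"
  have "uniformly_continuous_on ?K (\<lambda>(t, x). \<phi> t x)"
    by (intro compact_uniformly_continuous compact_Times compact_torus compact_Icc
          continuous_on_subset[OF continuous_flow]) auto
  then obtain d where d: "d > 0" "\<And>z z'. z \<in> ?K \<Longrightarrow> z' \<in> ?K \<Longrightarrow> dist z' z < d \<Longrightarrow>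
      dist ((\<lambda>(t, x). \<phi> t x) z') ((\<lambda>(t, x). \<phi> t x) z) < e"
    using \<open>e > 0\<close> unfolding uniformly_continuous_on_def by metis
  show ?thesis
  proof (rule that[of "d / 2"])
    fix s t :: real and x y :: torus
    assume st: "\<bar>s\<bar> \<le> M" "\<bar>t\<bar> \<le> M" "\<bar>s - t\<bar> < d / 2" "dist x y < d / 2"
    have "dist (s, x) (t, y) \<le> dist s t + dist x y"
      unfolding dist_Pair_Pair by (rule sqrt_sum_squares_le_sum) auto
    also have "\<dots> < d" using st by (simp add: dist_real_def)
    finally show "dist (\<phi> s x) (\<phi> t y) < e" using d(2)[of "(t, y)" "(s, x)"] st by (auto simp: abs_le_iff)
  qed (use d in simp)
qed

lemma differentiable_lifted_speed: "(g \<circ> torus_proj) differentiable at a"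
proof -
  have "times_differentiable (Suc 0) (g \<circ> torus_proj)" using smooth by (auto simp: smooth_on_torus_def)
  thus ?thesis by (auto simp: differentiable_on_def)
qed

lemma continuous_on_speed [continuous_intros]:
  "continuous_on A y \<Longrightarrow> continuous_on A (\<lambda>z. g (y z))"
proof -
  have "times_differentiable 0 (g \<circ> torus_proj)" using smooth by (simp only: smooth_on_torus_def)
  hence "continuous_on UNIV g" by (intro continuous_on_torus) simp
  thus "continuous_on A y \<Longrightarrow> continuous_on A (\<lambda>z. g (y z))"
    by (rule continuous_on_compose2) auto
qed

text \<open>The second integral accounts for negative times; for each \<open>t\<close> at most one of the two
  intervals is nondegenerate.\<close>

definition displacement :: "torus \<Rightarrow> real \<Rightarrow> real" where
  "displacement x t = integral {0..t} (\<lambda>\<tau>. g (\<phi> \<tau> x)) - integral {t..0} (\<lambda>\<tau>. g (\<phi> \<tau> x))"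

lemma displacement_0 [simp]: "displacement x 0 = 0"
  by (simp add: displacement_def)

lemma has_derivative_displacement:
  "(displacement x has_real_derivative g (\<phi> t x)) (at t)"
proof -
  define N where "N = \<bar>t\<bar> + 1"
  let ?v = "\<lambda>\<tau>. g (\<phi> \<tau> x)"
  have cont: "continuous_on A ?v" for A by (intro continuous_intros)
  have int: "?v integrable_on {a..b}" for a b by (intro integrable_continuous_real cont)
  \<comment> \<open>Near \<open>t\<close> the displacement is one integral with a fixed lower bound, up to a constant.\<close>
  have eq: "integral {-N..s} ?v - integral {-N..0} ?v = displacement x s" if "s \<in> {-N<..<N}" for s
  proof (cases "s \<ge> 0")
    case True
    thus ?thesis using Henstock_Kurzweil_Integration.integral_combine[of "-N" 0 s ?v] int that
      by (cases "s = 0") (auto simp: displacement_def)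
  next
    case False
    thus ?thesis using Henstock_Kurzweil_Integration.integral_combine[of "-N" s 0 ?v] int that
      by (auto simp: displacement_def)
  qed
  have "((\<lambda>s. integral {-N..s} ?v) has_real_derivative ?v t) (at t within {-N..N})"
    by (rule integral_has_real_derivative[OF cont]) (auto simp: N_def)
  hence "((\<lambda>s. integral {-N..s} ?v) has_real_derivative ?v t) (at t)"
    by (subst (asm) at_within_interior) (auto simp: N_def)
  hence "((\<lambda>s. integral {-N..s} ?v - integral {-N..0} ?v) has_real_derivative ?v t) (at t)"
    by (auto intro!: derivative_eq_intros)
  thus ?thesis
    by (rule has_field_derivative_transform_within_open[of _ _ _ "{-N<..<N}"])
       (use eq in \<open>auto simp: N_def\<close>)
qed

lemma continuous_on_displacement: "continuous_on A (displacement x)"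
  by (rule continuous_on_subset[OF _ subset_UNIV], rule DERIV_continuous_on)
     (rule has_field_derivative_at_within[OF has_derivative_displacement])

lemma displacement_mono: "s \<le> t \<Longrightarrow> displacement x s \<le> displacement x t"
  by (rule DERIV_nonneg_imp_nondecreasing) (use has_derivative_displacement g_nonneg in blast)+

lemma continuous_displacement_initial:
  assumes "t \<ge> 0"
  shows "continuous_on A (\<lambda>x. displacement x t)"
proof -
  have "continuous_on UNIV (\<lambda>x. integral (cbox 0 t) (\<lambda>\<tau>. g (\<phi> \<tau> x)))"
    by (rule integral_continuous_on_param) (auto intro!: continuous_intros simp: case_prod_unfold)
  moreover have "integral {t..0} (\<lambda>\<tau>. g (\<phi> \<tau> x)) = 0" for x
    using assms by (cases "t = 0") auto
  ultimately show ?thesis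
    unfolding displacement_def by (auto intro: continuous_on_subset)
qed

text \<open>The orbit and its proposed form agree at time \<open>0\<close>, and they have the same velocity at every
  time, so the distance between them has derivative zero.\<close>

lemma flow_eq_translate: "\<phi> t (torus_proj a) = torus_proj (a + displacement (torus_proj a) t *\<^sub>R F)"
proof -
  let ?x = "torus_proj a"
  let ?c = "\<lambda>s. a + displacement ?x s *\<^sub>R F"
  define h where "h s = dist (\<phi> s ?x) (torus_proj (?c s))" for s
  have "(h has_real_derivative 0) (at t)" for t
  proof -
    let ?v = "g (\<phi> t ?x) *\<^sub>R F"
    obtain u where u: "\<forall>\<^sub>F s in nhds t. torus_proj (u s) = \<phi> s ?x"
        "(u has_vector_derivative ?v) (at t)"
      using flow unfolding flow_generated_by_def has_velocity_def by blast
    have "(?c has_vector_derivative ?v) (at t)"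
      by (auto intro!: derivative_eq_intros has_derivative_displacement)
    hence "((\<lambda>s. u s - ?c s) has_vector_derivative 0) (at t)"
      using has_vector_derivative_diff[OF u(2)] by fastforce
    hence lim: "((\<lambda>s. norm ((u s - ?c s) - (u t - ?c t)) / norm (s - t)) \<longlongrightarrow> 0) (at t)"
      unfolding has_vector_derivative_def has_derivative_iff_norm by simp
    have ut: "torus_proj (u t) = \<phi> t ?x" using u(1) by (rule eventually_nhds_x_imp_x)
    have bound: "\<bar>h s - h t\<bar> \<le> norm ((u s - ?c s) - (u t - ?c t))"
      if s: "torus_proj (u s) = \<phi> s ?x" for s
    proof -
      let ?q = "torus_proj (u t + (?c s - ?c t))"
      have "h t = dist ?q (torus_proj (?c t + (?c s - ?c t)))"
        unfolding h_def dist_torus_proj_translate ut ..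
      also have "?c t + (?c s - ?c t) = ?c s" by simp
      finally have "\<bar>h s - h t\<bar> \<le> dist (torus_proj (u s)) ?q"
        unfolding h_def s using dist_triangle[of "\<phi> s ?x" "torus_proj (?c s)" ?q]
          dist_triangle[of ?q "torus_proj (?c s)" "\<phi> s ?x"]
        by (simp add: dist_commute)
      also have "\<dots> \<le> dist (u s) (u t + (?c s - ?c t))" by (rule dist_torus_proj_le)
      also have "\<dots> = norm ((u s - ?c s) - (u t - ?c t))" by (simp add: dist_norm algebra_simps)
      finally show ?thesis .
    qed
    have "((\<lambda>s. (h s - h t) / (s - t)) \<longlongrightarrow> 0) (at t)"
    proof (rule Lim_null_comparison[OF _ lim])
      have "\<forall>\<^sub>F s in at t. torus_proj (u s) = \<phi> s ?x"
        using u(1) by (simp add: eventually_nhds_conv_at)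
      thus "\<forall>\<^sub>F s in at t. norm ((h s - h t) / (s - t))
              \<le> norm ((u s - ?c s) - (u t - ?c t)) / norm (s - t)"
        by eventually_elim (use bound in \<open>auto intro: divide_right_mono\<close>)
    qed
    thus ?thesis by (simp add: has_field_derivative_iff)
  qed
  hence "h t = h 0" by (intro DERIV_isconst_all) auto
  thus ?thesis by (simp add: h_def)
qed

text \<open>A continuous speed alone would not suffice: with speed \<open>\<bar>s\<bar> powr (2/3)\<close> along the line, the
  motion crosses the zero in finite time. Differentiability gives a speed of at most \<open>K s\<close> at
  distance \<open>s\<close> ahead of the zero, and by Gronwall's argument (\<open>D s * exp (- K * s)\<close> does not
  increase) a point that starts at the zero does not leave it.\<close>

lemma flow_fixes_zero:
  assumes "t \<ge> 0"
  shows "\<phi> t p = p"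
proof -
  obtain P where P: "p = torus_proj P" by (rule torus_proj_cases)
  define h where "h s = g (torus_proj (P + s *\<^sub>R F))" for s
  have h0: "h 0 = 0" using g_zero_iff P by (simp add: h_def)
  obtain K \<eta> where K: "\<eta> > 0" "\<And>s. 0 \<le> s \<Longrightarrow> s \<le> \<eta> \<Longrightarrow> h s \<le> K * s"
  proof -
    have "((g \<circ> torus_proj) \<circ> (\<lambda>s. P + s *\<^sub>R F)) differentiable at 0"
      by (intro differentiable_chain_at differentiable_lifted_speed) (auto intro!: derivative_intros)
    hence "h differentiable at 0" by (simp add: h_def[abs_def] o_def)
    then obtain D where "(h has_real_derivative D) (at 0)"
      using real_differentiable_def by blast
    hence "((\<lambda>s. h s / s) \<longlongrightarrow> D) (at 0)" by (simp add: has_field_derivative_iff h0)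
    hence "\<forall>\<^sub>F s in at 0. h s / s < D + 1" by (rule order_tendstoD) simp
    then obtain \<eta> where \<eta>: "\<eta> > 0" "\<And>s. s \<noteq> 0 \<Longrightarrow> \<bar>s\<bar> < \<eta> \<Longrightarrow> h s / s < D + 1"
      unfolding eventually_at by (auto simp: dist_real_def)
    show ?thesis
    proof (rule that[of "\<eta> / 2" "D + 1"])
      fix s :: real assume "0 \<le> s" "s \<le> \<eta> / 2"
      thus "h s \<le> (D + 1) * s"
        using \<eta>(2)[of s] \<eta>(1) h0 by (cases "s = 0") (auto simp: field_simps)
    qed (use \<eta> in simp)
  qed
  let ?D = "displacement p"
  have deriv: "(?D has_real_derivative h (?D s)) (at s)" for s
    using has_derivative_displacement[of p s] flow_eq_translate[of s P] by (simp add: h_def P)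
  have "?D t = 0"
  proof (rule ccontr)
    assume "?D t \<noteq> 0"
    hence pos: "?D t > 0" using displacement_mono[OF assms, of p] by simp
    \<comment> \<open>Stop early enough for the linear bound to hold all the way.\<close>
    obtain t' where t': "0 \<le> t'" "?D t' = min \<eta> (?D t)"
      using IVT'[of ?D 0 "min \<eta> (?D t)" t] pos K(1) assms continuous_on_displacement by auto
    have "?D t' * exp (- K * t') \<le> ?D 0 * exp (- K * 0)"
    proof (rule DERIV_nonpos_imp_nonincreasing[OF t'(1)])
      fix s assume s: "0 \<le> s" "s \<le> t'"
      have "((\<lambda>s. ?D s * exp (- K * s)) has_real_derivative
          (h (?D s) - K * ?D s) * exp (- K * s)) (at s)"
        by (auto intro!: derivative_eq_intros deriv simp: algebra_simps)
      moreover have "h (?D s) \<le> K * ?D s"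
        using displacement_mono[OF s(1), of p] displacement_mono[OF s(2), of p] t'(2) by (intro K) auto
      ultimately show "\<exists>y. ((\<lambda>s. ?D s * exp (- K * s)) has_real_derivative y) (at s) \<and> y \<le> 0"
        by (meson diff_le_0_iff_le exp_ge_zero mult_nonpos_nonneg)
    qed
    thus False using t'(2) pos K(1) by (auto simp: mult_le_0_iff min_def split: if_splits)
  qed
  thus ?thesis using flow_eq_translate[of t P] by (simp add: P)
qed

lemma flow_hits_zero_iff:
  assumes "t \<ge> 0"
  shows "\<phi> t x = p \<longleftrightarrow> x = p"
proof
  assume "\<phi> t x = p"
  hence "\<phi> (- t) (\<phi> t x) = \<phi> (- t) (\<phi> t p)" using flow_fixes_zero[OF assms] by simp
  thus "x = p" by (simp flip: flow_add)
qed (use flow_fixes_zero[OF assms] in simp)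

section \<open>Bounded and unbounded motion along the lines\<close>

text \<open>The displacement converges, so its increments over unit time tend to zero. They are values
  of \<open>g\<close> at intermediate points of the orbit, which converge to the limit of the orbit; there \<open>g\<close>
  vanishes.\<close>

lemma bounded_displacement_converges:
  assumes bound: "\<And>t. t \<ge> 0 \<Longrightarrow> displacement (torus_proj a) t \<le> B"
  obtains L where "L \<ge> 0" "L \<le> B" "torus_proj (a + L *\<^sub>R F) = p"
    "(\<lambda>n. \<phi> (real n) (torus_proj a)) \<longlonglongrightarrow> p"
proof -
  let ?x = "torus_proj a"
  let ?D = "displacement ?x"
  have incseq: "incseq (\<lambda>n. ?D (real n))" by (intro incseq_SucI displacement_mono) simp
  obtain L where L: "(\<lambda>n. ?D (real n)) \<longlonglongrightarrow> L" "\<And>n. ?D (real n) \<le> L"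
    using incseq_convergent[OF incseq, of B] bound by auto
  define z where "z = torus_proj (a + L *\<^sub>R F)"
  have proj: "(\<lambda>n. torus_proj (X n)) \<longlonglongrightarrow> torus_proj l" if "X \<longlonglongrightarrow> l" for X l
    using continuous_on_tendsto_compose[OF continuous_on_torus_proj[of UNIV] that] by simp
  have xz: "(\<lambda>n. \<phi> (real n) ?x) \<longlonglongrightarrow> z"
    unfolding z_def flow_eq_translate by (intro proj tendsto_intros L)
  have "\<exists>\<xi>>real n. \<xi> < real (Suc n) \<and> ?D (real (Suc n)) - ?D (real n) = g (\<phi> \<xi> ?x)" for n
    using MVT2[of "real n" "real (Suc n)" ?D "\<lambda>t. g (\<phi> t ?x)"] has_derivative_displacement by auto
  then obtain \<xi> where \<xi>: "\<And>n. \<xi> n > real n" "\<And>n. \<xi> n < real (Suc n)"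
      "\<And>n. ?D (real (Suc n)) - ?D (real n) = g (\<phi> (\<xi> n) ?x)" by metis
  have "(\<lambda>n. ?D (\<xi> n)) \<longlonglongrightarrow> L"
  proof (rule tendsto_sandwich[OF _ _ L(1) LIMSEQ_Suc[OF L(1)]])
    show "\<forall>\<^sub>F n in sequentially. ?D (real n) \<le> ?D (\<xi> n)"
      by (intro always_eventually allI displacement_mono less_imp_le \<xi>(1))
    show "\<forall>\<^sub>F n in sequentially. ?D (\<xi> n) \<le> ?D (real (Suc n))"
      by (intro always_eventually allI displacement_mono less_imp_le \<xi>(2))
  qed
  hence "(\<lambda>n. \<phi> (\<xi> n) ?x) \<longlonglongrightarrow> z"
    unfolding z_def flow_eq_translate by (intro proj tendsto_intros)
  hence "(\<lambda>n. g (\<phi> (\<xi> n) ?x)) \<longlonglongrightarrow> g z"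
    using continuous_on_tendsto_compose[OF continuous_on_speed[OF continuous_on_id, of UNIV]] by simp
  moreover have "(\<lambda>n. ?D (real (Suc n)) - ?D (real n)) \<longlonglongrightarrow> L - L"
    by (intro tendsto_diff L(1) LIMSEQ_Suc[OF L(1)])
  ultimately have "g z = 0" unfolding \<xi>(3) using LIMSEQ_unique by fastforce
  hence "z = p" by (simp add: g_zero_iff)
  moreover have "L \<ge> 0" using L(2)[of 0] by simp
  moreover have "L \<le> B" using LIMSEQ_le_const2[OF L(1)] bound by auto
  ultimately show ?thesis using that xz z_def by simp
qed

definition runs_away :: "torus \<Rightarrow> bool" where
  "runs_away x \<longleftrightarrow> (\<forall>B. \<exists>t\<ge>0. displacement x t > B)"

lemma converges_or_runs_away:
  "(\<lambda>n. \<phi> (real n) x) \<longlonglongrightarrow> p \<or> runs_away x"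
proof (cases "runs_away x")
  case False
  then obtain B where B: "\<And>t. t \<ge> 0 \<Longrightarrow> displacement x t \<le> B"
    unfolding runs_away_def by (meson not_le)
  obtain a where "x = torus_proj a" by (rule torus_proj_cases)
  thus ?thesis using bounded_displacement_converges B by metis
qed simp

lemma zero_not_on_own_line:
  assumes "p = torus_proj P" "torus_proj (P + s *\<^sub>R F) = p"
  shows "s = 0"
  using assms irrational_line_no_return[OF irrational, of s] by (simp add: torus_proj_eq_iff)

text \<open>Otherwise the orbit would converge to \<open>p\<close> along the line, and the line would come back to its
  point \<open>p\<close>.\<close>

lemma runs_away_ahead_of_zero:
  assumes "p = torus_proj P" "s > 0"
  shows "runs_away (torus_proj (P + s *\<^sub>R F))"
proof (rule ccontr)
  assume "\<not> runs_away (torus_proj (P + s *\<^sub>R F))"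
  then obtain B where "\<And>t. t \<ge> 0 \<Longrightarrow> displacement (torus_proj (P + s *\<^sub>R F)) t \<le> B"
    unfolding runs_away_def by (meson not_le)
  then obtain L where "L \<ge> 0" "torus_proj (P + s *\<^sub>R F + L *\<^sub>R F) = p"
    by (rule bounded_displacement_converges)
  hence "torus_proj (P + (s + L) *\<^sub>R F) = p" by (simp add: algebra_simps)
  thus False using zero_not_on_own_line[OF assms(1)] \<open>L \<ge> 0\<close> \<open>s > 0\<close> by fastforce
qed

text \<open>The displacement cannot exceed \<open>s\<close>, since the orbit would first have to pass \<open>p\<close>, which no
  other point reaches in finite time.\<close>

lemma converges_behind_zero:
  assumes "p = torus_proj P" "s > 0"
  shows "(\<lambda>n. \<phi> (real n) (torus_proj (P + s *\<^sub>R (- F)))) \<longlonglongrightarrow> p"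
proof -
  let ?x = "torus_proj (P + s *\<^sub>R (- F))"
  have "displacement ?x t \<le> s" if t: "t \<ge> 0" for t
  proof (rule ccontr)
    assume "\<not> displacement ?x t \<le> s"
    hence "displacement ?x 0 \<le> s" "s \<le> displacement ?x t" using \<open>s > 0\<close> by auto
    then obtain t' where t': "t' \<ge> 0" "displacement ?x t' = s"
      using IVT'[OF _ _ t continuous_on_displacement] by blast
    have "\<phi> t' ?x = p" unfolding flow_eq_translate t'(2) using assms(1) by simp
    hence "torus_proj (P + (- s) *\<^sub>R F) = p" using flow_hits_zero_iff[OF t'(1)] by simp
    thus False using zero_not_on_own_line[OF assms(1)] \<open>s > 0\<close> by fastforce
  qed
  thus ?thesis by (rule bounded_displacement_converges)
qed

text \<open>The constant is the same for all points, which is what gives a constant of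
  sensitivity. Near \<open>p\<close> the flow is so slow that closeness to \<open>p\<close> at integer times gives
  closeness, within \<open>1/8\<close>, at all times in between. An orbit that is so close to \<open>p\<close> from some time
  on covers, in the plane, a connected piece of a line of norm less than \<open>1/4\<close>, so its
  displacement is bounded.\<close>

lemma runs_away_leaves_zero:
  obtains c where "c > 0" "\<And>x N. runs_away x \<Longrightarrow> \<exists>n\<ge>N. dist (\<phi> (real n) x) p \<ge> c"
proof -
  obtain c where c: "c > 0" "\<And>s t x y. \<bar>s\<bar> \<le> 1 \<Longrightarrow> \<bar>t\<bar> \<le> 1 \<Longrightarrow> \<bar>s - t\<bar> < c \<Longrightarrow>
      dist x y < c \<Longrightarrow> dist (\<phi> s x) (\<phi> t y) < 1 / 8"
    using flow_uniformly_continuous[of "1 / 8" 1] by (metis zero_less_divide_1_iff zero_less_numeral)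
  show ?thesis
  proof (rule that[OF \<open>c > 0\<close>], rule ccontr)
    fix x N assume away: "runs_away x" and "\<not> (\<exists>n\<ge>N. c \<le> dist (\<phi> (real n) x) p)"
    hence near: "dist (\<phi> (real n) x) p < c" if "n \<ge> N" for n using that by force
    have near': "dist (\<phi> t x) p < 1 / 8" if "t \<ge> real N" for t
    proof -
      define n where "n = nat \<lfloor>t\<rfloor>"
      have n: "real n \<le> t" "t \<le> real n + 1" "n \<ge> N" using that unfolding n_def by linarith+
      have "dist (\<phi> (t - real n) (\<phi> (real n) x)) (\<phi> (t - real n) p) < 1 / 8"
        using n near[OF n(3)] c(1) by (intro c(2)) auto
      thus ?thesis using n by (simp add: flow_fixes_zero flip: flow_add)
    qed
    obtain a where a: "x = torus_proj a" by (rule torus_proj_cases)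
    let ?b = "\<lambda>t. (displacement x t - displacement x (real N)) *\<^sub>R F"
    have "F \<noteq> 0" using irrational by (auto simp: irrational_slope_def)
    have "norm (?b t) < 1 / 4" if "t \<ge> real N" for t
    proof (rule norm_less_of_connected_lift[of "?b ` {real N..}"])
      show "connected (?b ` {real N..})"
        by (intro connected_continuous_image continuous_intros continuous_on_displacement) simp
      show "0 \<in> ?b ` {real N..}" by (rule image_eqI[of _ _ "real N"]) auto
      fix b assume "b \<in> ?b ` {real N..}"
      then obtain s where s: "s \<ge> real N" "b = ?b s" by auto
      let ?w = "a + displacement x (real N) *\<^sub>R F"
      have "dist (torus_proj b) (torus_proj 0) = dist (torus_proj (b + ?w)) (torus_proj (0 + ?w))"
        by (rule dist_torus_proj_translate[symmetric])
      also have "\<dots> = dist (\<phi> s x) (\<phi> (real N) x)"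
        unfolding a flow_eq_translate s by (simp add: algebra_simps)
      also have "\<dots> < 1 / 4"
        using near'[OF s(1)] near'[of "real N"] dist_triangle2[of "\<phi> s x" "\<phi> (real N) x" p] by simp
      finally show "dist (torus_proj b) (torus_proj 0) < 1 / 4" .
    qed (use that in auto)
    moreover obtain t where t: "t \<ge> 0" "displacement x t > displacement x (real N) + 1 / norm F"
      using away unfolding runs_away_def by blast
    moreover have "t \<ge> real N"
    proof (rule ccontr)
      assume "\<not> t \<ge> real N"
      hence "displacement x t \<le> displacement x (real N)" by (intro displacement_mono) simp
      moreover have "1 / norm F \<ge> 0" by simp
      ultimately show False using t(2) by linarith
    qed
    ultimately have "\<bar>displacement x t - displacement x (real N)\<bar> * norm F < 1 / 4" by simp
    moreover have "(1 / norm F) * norm F \<le> \<bar>displacement x t - displacement x (real N)\<bar> * norm F"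
      using t(2) by (intro mult_right_mono) auto
    ultimately show False using \<open>F \<noteq> 0\<close> by simp
  qed
qed

section \<open>Sensitivity\<close>

lemma funpow_flow: "(\<phi> 1 ^^ n) x = \<phi> (real n) x"
  by (induction n) (simp_all add: flow_add[symmetric])

theorem sensitive_time_one_map: "sensitive (\<phi> 1)"
proof -
  obtain P where P: "p = torus_proj P" by (rule torus_proj_cases)
  obtain c where c: "c > 0" "\<And>x N. runs_away x \<Longrightarrow> \<exists>n\<ge>N. dist (\<phi> (real n) x) p \<ge> c"
    using runs_away_leaves_zero by blast
  have separate: "\<exists>n\<ge>1. dist (\<phi> (real n) x) (\<phi> (real n) y) > c / 2"
    if x: "(\<lambda>n. \<phi> (real n) x) \<longlonglongrightarrow> p" and y: "runs_away y" for x y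
  proof -
    obtain N where N: "\<And>n. n \<ge> N \<Longrightarrow> dist (\<phi> (real n) x) p < c / 2"
      using x half_gt_zero[OF \<open>c > 0\<close>] unfolding lim_sequentially by blast
    obtain n where "n \<ge> max 1 N" "dist (\<phi> (real n) y) p \<ge> c" using c(2)[OF y] by blast
    thus ?thesis using N[of n] dist_triangle2[of "\<phi> (real n) y" p "\<phi> (real n) x"]
      by (intro exI[of _ n]) (auto simp: dist_commute)
  qed
  have "\<exists>y. dist x y < \<delta> \<and> (\<exists>n\<ge>1. dist (\<phi> (real n) x) (\<phi> (real n) y) > c / 2)" if "\<delta> > 0" for x \<delta>
  proof (cases "runs_away x")
    case False
    obtain s where s: "s > 0" "dist (torus_proj (P + s *\<^sub>R F)) x < \<delta>"
      using irrational_half_line_dense[OF irrational \<open>\<delta> > 0\<close>] .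
    thus ?thesis
      using separate[OF _ runs_away_ahead_of_zero[OF P s(1)]] converges_or_runs_away[of x] False
      by (metis dist_commute)
  next
    case True
    have "irrational_slope (- F)" using irrational by (simp add: irrational_slope_def)
    then obtain s where s: "s > 0" "dist (torus_proj (P + s *\<^sub>R (- F))) x < \<delta>"
      using irrational_half_line_dense[OF _ \<open>\<delta> > 0\<close>] by metis
    thus ?thesis using separate[OF converges_behind_zero[OF P s(1)] True] by (metis dist_commute)
  qed
  thus ?thesis unfolding sensitive_def sensitivity_constant_def funpow_flow
    using \<open>c > 0\<close> by (intro exI[of _ "c / 2"]) auto
qed

section \<open>Late images of small balls are not stretched\<close>

text \<open>The displacement has positive derivative at time \<open>0\<close>, so its values on \<open>{- \<tau>0..\<tau>0}\<close> fill a
  neighbourhood of \<open>0\<close>.\<close>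

lemma short_segment_is_orbit_arc:
  assumes "torus_proj a \<noteq> p" "\<tau>0 > 0"
  obtains s0 where "s0 > 0"
    "\<And>s. \<bar>s\<bar> \<le> s0 \<Longrightarrow> \<exists>\<tau>. \<bar>\<tau>\<bar> \<le> \<tau>0 \<and> torus_proj (a + s *\<^sub>R F) = \<phi> \<tau> (torus_proj a)"
proof -
  let ?D = "displacement (torus_proj a)"
  have "g (\<phi> 0 (torus_proj a)) > 0"
    using assms(1) g_zero_iff[of "torus_proj a"] g_nonneg[of "torus_proj a"] by simp
  note increasing = DERIV_pos_inc_right[OF has_derivative_displacement this]
    DERIV_pos_inc_left[OF has_derivative_displacement this]
  obtain d d' where d: "d > 0" "\<And>h. 0 < h \<Longrightarrow> h < d \<Longrightarrow> 0 < ?D h"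
    and d': "d' > 0" "\<And>h. 0 < h \<Longrightarrow> h < d' \<Longrightarrow> ?D (- h) < 0"
    using increasing by auto
  define h where "h = min \<tau>0 (min (d / 2) (d' / 2))"
  have h: "h > 0" "h \<le> \<tau>0" "?D h > 0" "?D (- h) < 0"
    using d d' \<open>\<tau>0 > 0\<close> by (auto simp: h_def min_def)
  show ?thesis
  proof (rule that[of "min (?D h) (- ?D (- h))"])
    fix s assume "\<bar>s\<bar> \<le> min (?D h) (- ?D (- h))"
    hence "?D (- h) \<le> s" "s \<le> ?D h" by auto
    then obtain \<tau> where "- h \<le> \<tau>" "\<tau> \<le> h" "?D \<tau> = s"
      using IVT'[of ?D "- h" s h] h(1) continuous_on_displacement by force
    thus "\<exists>\<tau>. \<bar>\<tau>\<bar> \<le> \<tau>0 \<and> torus_proj (a + s *\<^sub>R F) = \<phi> \<tau> (torus_proj a)"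
      using flow_eq_translate[of \<tau> a] h(2) by (intro exI[of _ \<tau>]) auto
  qed (use h in simp)
qed

text \<open>Two points of the plane keep their transversal offset \<open>w\<close> for all times, since the flow moves
  both in direction \<open>F\<close>; only the longitudinal offset \<open>s\<close> changes. The lift of the image is
  connected, so a small diameter in the torus bounds the offset in the plane, not only
  modulo the lattice.\<close>

lemma small_image_is_thin_strip:
  assumes "t \<ge> 0" "diameter (\<phi> t ` ball x r) < c" "c \<le> 1 / 4" "y \<in> ball x r"
    and "\<phi> t x = torus_proj b"
  obtains w s where "norm w < r" "norm (w + s *\<^sub>R F) < c" "\<phi> t y = torus_proj (b + w + s *\<^sub>R F)"
proof -
  obtain a where a: "x = torus_proj a" by (rule torus_proj_cases)
  have "dist x y < r" using assms(4) by simp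
  then obtain w where w: "norm w < r" "y = torus_proj (a + w)"
    unfolding a by (rule torus_near_lift)
  define s where "s v = displacement (torus_proj (a + v)) t - displacement x t" for v
  define b' where "b' = a + displacement x t *\<^sub>R F"
  have image: "\<phi> t (torus_proj (a + v)) = torus_proj (v + s v *\<^sub>R F + b')" for v
    unfolding flow_eq_translate b'_def s_def by (simp add: algebra_simps)
  have "torus_proj b = torus_proj b'"
    using assms(5) unfolding a b'_def flow_eq_translate by simp
  hence "\<phi> t y = torus_proj (b + w + s w *\<^sub>R F)"
    unfolding w(2) image torus_proj_eq_iff using int_lattice_minus by fastforce
  moreover have "norm (w + s w *\<^sub>R F) < c"
  proof (rule norm_less_of_connected_lift[of "(\<lambda>v. v + s v *\<^sub>R F) ` ball 0 r"])
    have "continuous_on (ball 0 r) (\<lambda>v. displacement (torus_proj (a + v)) t)"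
      by (rule continuous_on_compose2[OF continuous_displacement_initial[OF assms(1), of UNIV]])
         (auto intro!: continuous_on_compose2[OF continuous_on_torus_proj[of UNIV]] continuous_intros)
    thus "connected ((\<lambda>v. v + s v *\<^sub>R F) ` ball 0 r)"
      unfolding s_def by (intro connected_continuous_image continuous_intros) auto
    have "r > 0" using w(1) norm_ge_zero[of w] by linarith
    thus "0 \<in> (\<lambda>v. v + s v *\<^sub>R F) ` ball 0 r" by (intro image_eqI[of _ _ 0]) (auto simp: s_def a)
    show "w + s w *\<^sub>R F \<in> (\<lambda>v. v + s v *\<^sub>R F) ` ball 0 r" using w(1) by auto
    fix e assume "e \<in> (\<lambda>v. v + s v *\<^sub>R F) ` ball 0 r"
    then obtain v where v: "norm v < r" "e = v + s v *\<^sub>R F" by auto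
    have "dist (torus_proj e) (torus_proj 0) = dist (torus_proj (e + b')) (torus_proj (0 + b'))"
      by (rule dist_torus_proj_translate[symmetric])
    also have "\<dots> = dist (\<phi> t (torus_proj (a + v))) (\<phi> t x)"
      unfolding image v a by (simp add: flow_eq_translate b'_def a)
    also have "\<dots> \<le> diameter (\<phi> t ` ball x r)"
    proof (rule diameter_bounded_bound)
      show "bounded (\<phi> t ` ball x r)"
        using compact_imp_bounded[OF compact_torus] bounded_subset by blast
      have "dist x (torus_proj (a + v)) < r"
        using dist_torus_proj_le[of a "a + v"] v(1) by (simp add: a dist_norm)
      thus "\<phi> t (torus_proj (a + v)) \<in> \<phi> t ` ball x r" by simp
      show "\<phi> t x \<in> \<phi> t ` ball x r" using \<open>r > 0\<close> by simp
    qed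
    also have "\<dots> < c" by (rule assms(2))
    finally show "dist (torus_proj e) (torus_proj 0) < c" .
  qed (rule assms(3))
  ultimately show ?thesis using that w(1) by blast
qed

text \<open>The point is the order of the choices: \<open>\<gamma>\<close> does not depend on \<open>M\<close>; only the radius \<open>\<eta>\<close>
  does. Up to an error that \<open>\<eta>\<close> controls, the image of the ball at time \<open>t\<close> lies on an arc
  \<open>\<phi> \<tau> q\<close> with \<open>\<bar>\<tau>\<bar> \<le> \<tau>0\<close>, and \<open>\<phi> i (\<phi> \<tau> q) = \<phi> \<tau> (\<phi> i q)\<close> is close to \<open>\<phi> i q\<close> for all \<open>i\<close>.\<close>

lemma no_stretching_away_from_zero:
  assumes "q \<noteq> p" "\<epsilon> > 0"
  obtains \<gamma> where "\<gamma> > 0" "\<gamma> \<le> \<epsilon>"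
    "\<And>M. \<exists>\<eta>>0. \<forall>t\<ge>0. \<forall>x r i. r < \<eta> \<longrightarrow> dist (\<phi> t x) q < \<eta> \<longrightarrow> diameter (\<phi> t ` ball x r) \<le> \<gamma> \<longrightarrow>
       \<bar>i\<bar> \<le> M \<longrightarrow> diameter (\<phi> (t + i) ` ball x r) \<le> \<epsilon>"
proof -
  have "F \<noteq> 0" using irrational by (auto simp: irrational_slope_def)
  obtain Q where Q: "q = torus_proj Q" by (rule torus_proj_cases)
  obtain \<tau>0 where \<tau>0: "\<tau>0 > 0" "\<And>y \<tau>. \<bar>\<tau>\<bar> \<le> \<tau>0 \<Longrightarrow> dist (\<phi> \<tau> y) y < \<epsilon> / 4"
  proof -
    obtain d where d: "d > 0" "\<And>s t x y. \<bar>s\<bar> \<le> 1 \<Longrightarrow> \<bar>t\<bar> \<le> 1 \<Longrightarrow> \<bar>s - t\<bar> < d \<Longrightarrow>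
        dist x y < d \<Longrightarrow> dist (\<phi> s x) (\<phi> t y) < \<epsilon> / 4"
      using flow_uniformly_continuous[of "\<epsilon> / 4" 1] \<open>\<epsilon> > 0\<close> by (metis zero_less_divide_iff zero_less_numeral)
    show ?thesis
    proof (rule that[of "min 1 (d / 2)"])
      fix \<tau> y assume "\<bar>\<tau>\<bar> \<le> min 1 (d / 2)"
      thus "dist (\<phi> \<tau> y) y < \<epsilon> / 4" using d(2)[of \<tau> 0 y y] d(1) by auto
    qed (use d in simp)
  qed
  obtain s0 where s0: "s0 > 0" "\<And>s. \<bar>s\<bar> \<le> s0 \<Longrightarrow> \<exists>\<tau>. \<bar>\<tau>\<bar> \<le> \<tau>0 \<and> torus_proj (Q + s *\<^sub>R F) = \<phi> \<tau> q"
    using short_segment_is_orbit_arc[OF _ \<tau>0(1), of Q] assms(1) Q by metis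
  define l where "l = s0 * norm F"
  have "l > 0" using \<open>s0 > 0\<close> \<open>F \<noteq> 0\<close> by (simp add: l_def)
  \<comment> \<open>Bounds for \<open>2 * \<gamma>\<close>: by \<open>1/4\<close> to lift the image to the plane, and by \<open>l / 2\<close> to leave room
    for the transversal offset.\<close>
  define \<gamma> where "\<gamma> = min \<epsilon> (min (1 / 8) (l / 4))"
  show ?thesis
  proof (rule that[of \<gamma>])
    show \<gamma>: "\<gamma> > 0" "\<gamma> \<le> \<epsilon>" using \<open>\<epsilon> > 0\<close> \<open>l > 0\<close> by (auto simp: \<gamma>_def)
    fix M :: real
    obtain d where d: "d > 0" "\<And>s t x y. \<bar>s\<bar> \<le> M \<Longrightarrow> \<bar>t\<bar> \<le> M \<Longrightarrow> \<bar>s - t\<bar> < d \<Longrightarrow>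
        dist x y < d \<Longrightarrow> dist (\<phi> s x) (\<phi> t y) < \<epsilon> / 8"
      using flow_uniformly_continuous[of "\<epsilon> / 8" M] \<open>\<epsilon> > 0\<close> by (metis zero_less_divide_iff zero_less_numeral)
    define \<eta> where "\<eta> = min (d / 2) (l / 2)"
    have "\<eta> > 0" using \<open>d > 0\<close> \<open>l > 0\<close> by (simp add: \<eta>_def)
    have "diameter (\<phi> (t + i) ` ball x r) \<le> \<epsilon>"
      if t: "t \<ge> 0" and r: "r < \<eta>" and near: "dist (\<phi> t x) q < \<eta>"
        and diam: "diameter (\<phi> t ` ball x r) \<le> \<gamma>" and i: "\<bar>i\<bar> \<le> M" for t x r i
    proof -
      have center: "dist (\<phi> (t + i) y) (\<phi> i q) < \<epsilon> / 2" if y: "y \<in> ball x r" for y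
      proof -
        obtain b where b: "\<phi> t x = torus_proj b" "norm (b - Q) < \<eta>"
        proof -
          have "dist (torus_proj Q) (\<phi> t x) < \<eta>" using near by (simp add: Q dist_commute)
          then obtain v where "norm v < \<eta>" "\<phi> t x = torus_proj (Q + v)" by (rule torus_near_lift)
          thus ?thesis using that[of "Q + v"] by simp
        qed
        obtain w s where ws: "norm w < r" "norm (w + s *\<^sub>R F) < 2 * \<gamma>"
            "\<phi> t y = torus_proj (b + w + s *\<^sub>R F)"
          by (rule small_image_is_thin_strip[OF t, of x r "2 * \<gamma>" y b])
             (use diam \<gamma> y b in \<open>auto simp: \<gamma>_def\<close>)
        have "norm (s *\<^sub>R F) \<le> norm (w + s *\<^sub>R F) + norm w"
          using norm_triangle_ineq4[of "w + s *\<^sub>R F" w] by simp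
        also have "\<dots> \<le> l" using ws r by (auto simp: \<gamma>_def \<eta>_def)
        finally have "\<bar>s\<bar> \<le> s0" using \<open>F \<noteq> 0\<close> by (simp add: l_def)
        then obtain \<tau> where \<tau>: "\<bar>\<tau>\<bar> \<le> \<tau>0" "torus_proj (Q + s *\<^sub>R F) = \<phi> \<tau> q" using s0(2) by blast
        have "dist (\<phi> t y) (\<phi> \<tau> q) \<le> norm ((b - Q) + w)"
          using dist_torus_proj_le[of "b + w + s *\<^sub>R F" "Q + s *\<^sub>R F"]
          unfolding ws(3) \<tau>(2) by (simp add: dist_norm algebra_simps)
        also have "\<dots> < d" using norm_triangle_ineq[of "b - Q" w] b(2) ws(1) r by (auto simp: \<eta>_def)
        finally have "dist (\<phi> i (\<phi> t y)) (\<phi> i (\<phi> \<tau> q)) < \<epsilon> / 8"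
          using i d(1) by (intro d(2)) auto
        moreover have "dist (\<phi> i (\<phi> \<tau> q)) (\<phi> i q) < \<epsilon> / 4"
          unfolding flow_commute[of i \<tau>] by (rule \<tau>0(2)[OF \<tau>(1)])
        ultimately have "dist (\<phi> i (\<phi> t y)) (\<phi> i q) < \<epsilon> / 2"
          using dist_triangle[of "\<phi> i (\<phi> t y)" "\<phi> i q" "\<phi> i (\<phi> \<tau> q)"] \<open>\<epsilon> > 0\<close> by linarith
        thus ?thesis by (simp add: add.commute[of t i] flow_add)
      qed
      show ?thesis
      proof (rule diameter_leI)
        fix u v assume "u \<in> \<phi> (t + i) ` ball x r" "v \<in> \<phi> (t + i) ` ball x r"
        hence "dist u (\<phi> i q) < \<epsilon> / 2" "dist v (\<phi> i q) < \<epsilon> / 2" using center by auto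
        thus "dist u v \<le> \<epsilon>" by (metis dist_commute dist_triangle_half_r less_imp_le)
      qed (use \<open>\<epsilon> > 0\<close> in simp)
    qed
    thus "\<exists>\<eta>>0. \<forall>t\<ge>0. \<forall>x r i. r < \<eta> \<longrightarrow> dist (\<phi> t x) q < \<eta> \<longrightarrow> diameter (\<phi> t ` ball x r) \<le> \<gamma> \<longrightarrow>
       \<bar>i\<bar> \<le> M \<longrightarrow> diameter (\<phi> (t + i) ` ball x r) \<le> \<epsilon>"
      using \<open>\<eta> > 0\<close> by blast
  qed
qed

lemma runs_away_limit_point:
  assumes "runs_away x"
  obtains q where "q \<noteq> p" "\<And>e A. e > 0 \<Longrightarrow> \<exists>n\<ge>A. dist (\<phi> (real n) x) q < e"
proof -
  obtain c where c: "c > 0" "\<And>N. \<exists>n\<ge>N. dist (\<phi> (real n) x) p \<ge> c"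
    using runs_away_leaves_zero assms by metis
  obtain n where n: "\<And>N. n N \<ge> N" "\<And>N. dist (\<phi> (real (n N)) x) p \<ge> c" using c(2) by metis
  let ?X = "\<lambda>N. \<phi> (real (n N)) x"
  obtain q r where r: "strict_mono r" "(?X \<circ> r) \<longlonglongrightarrow> q"
    using compact_torus unfolding compact_def by (metis UNIV_I)
  have "(\<lambda>k. dist ((?X \<circ> r) k) p) \<longlonglongrightarrow> dist q p" by (intro tendsto_intros r)
  hence "dist q p \<ge> c" using n(2) by (intro LIMSEQ_le_const) auto
  hence "q \<noteq> p" using \<open>c > 0\<close> by auto
  moreover have "\<exists>m\<ge>A. dist (\<phi> (real m) x) q < e" if e: "e > 0" for e A
  proof -
    obtain K where "\<And>k. k \<ge> K \<Longrightarrow> dist ((?X \<circ> r) k) q < e"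
      using r(2) e unfolding lim_sequentially by blast
    moreover have "n (r (max A K)) \<ge> A"
      using n(1)[of "r (max A K)"] seq_suble[OF r(1), of "max A K"] by simp
    ultimately show ?thesis by (intro exI[of _ "n (r (max A K))"]) auto
  qed
  ultimately show ?thesis using that by blast
qed

theorem not_first_time_sensitive_time_one_map: "\<not> first_time_sensitive (\<phi> 1)"
proof
  assume "first_time_sensitive (\<phi> 1)"
  then obtain \<epsilon> where "\<epsilon> > 0" and stretch: "\<And>\<gamma>. 0 < \<gamma> \<Longrightarrow> \<gamma> \<le> \<epsilon> \<Longrightarrow>
      \<exists>M. \<forall>x. \<forall>\<eta>>0. \<exists>A. \<forall>a\<ge>A. \<exists>r<\<eta>. diameter ((\<phi> 1 ^^ a) ` ball x r) \<le> \<gamma> \<and>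
        (\<exists>i\<le>M. diameter ((\<phi> 1 ^^ (a + i)) ` ball x r) > \<epsilon>)"
    using first_time_sensitive_late_stretching[OF compact_torus] by blast
  obtain P where P: "p = torus_proj P" by (rule torus_proj_cases)
  define x where "x = torus_proj (P + 1 *\<^sub>R F)"
  have "runs_away x" unfolding x_def by (rule runs_away_ahead_of_zero[OF P]) simp
  then obtain q where q: "q \<noteq> p" "\<And>e A. e > 0 \<Longrightarrow> \<exists>n\<ge>A. dist (\<phi> (real n) x) q < e"
    by (rule runs_away_limit_point) blast
  obtain \<gamma> where "\<gamma> > 0" "\<gamma> \<le> \<epsilon>" and tame: "\<And>M. \<exists>\<eta>>0. \<forall>t\<ge>0. \<forall>x r i. r < \<eta> \<longrightarrow>
      dist (\<phi> t x) q < \<eta> \<longrightarrow> diameter (\<phi> t ` ball x r) \<le> \<gamma> \<longrightarrow> \<bar>i\<bar> \<le> M \<longrightarrow>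
      diameter (\<phi> (t + i) ` ball x r) \<le> \<epsilon>"
    by (rule no_stretching_away_from_zero[OF q(1) \<open>\<epsilon> > 0\<close>]) blast
  obtain M where M: "\<And>x \<eta>. \<eta> > 0 \<Longrightarrow> \<exists>A. \<forall>a\<ge>A. \<exists>r<\<eta>. diameter ((\<phi> 1 ^^ a) ` ball x r) \<le> \<gamma> \<and>
        (\<exists>i\<le>M. diameter ((\<phi> 1 ^^ (a + i)) ` ball x r) > \<epsilon>)"
    using stretch[OF \<open>\<gamma> > 0\<close> \<open>\<gamma> \<le> \<epsilon>\<close>] by blast
  obtain \<eta> where "\<eta> > 0" and \<eta>: "\<And>t x r i. t \<ge> 0 \<Longrightarrow> r < \<eta> \<Longrightarrow> dist (\<phi> t x) q < \<eta> \<Longrightarrow>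
      diameter (\<phi> t ` ball x r) \<le> \<gamma> \<Longrightarrow> \<bar>i\<bar> \<le> real M \<Longrightarrow> diameter (\<phi> (t + i) ` ball x r) \<le> \<epsilon>"
    using tame[of "real M"] by blast
  have iterate: "(\<phi> 1 ^^ n) = \<phi> (real n)" for n by (rule ext) (rule funpow_flow)
  obtain A where A: "\<And>a. a \<ge> A \<Longrightarrow> \<exists>r<\<eta>. diameter (\<phi> (real a) ` ball x r) \<le> \<gamma> \<and>
        (\<exists>i\<le>M. diameter (\<phi> (real (a + i)) ` ball x r) > \<epsilon>)"
    using M[OF \<open>\<eta> > 0\<close>, of x] unfolding iterate by blast
  obtain a where a: "a \<ge> A" "dist (\<phi> (real a) x) q < \<eta>" using q(2)[OF \<open>\<eta> > 0\<close>] by blast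
  obtain r i where r: "r < \<eta>" "diameter (\<phi> (real a) ` ball x r) \<le> \<gamma>" "i \<le> M"
      "diameter (\<phi> (real (a + i)) ` ball x r) > \<epsilon>"
    using A[OF a(1)] by blast
  show False using \<eta>[of "real a" r x "real i"] r a(2) by simp
qed

end

theorem proposition3p18:
  fixes F :: "real ^ 2" and g :: "torus \<Rightarrow> real" and p :: torus
    and \<phi> :: "real \<Rightarrow> torus \<Rightarrow> torus" and f :: "torus \<Rightarrow> torus"
  assumes "irrational_slope F"
    and "smooth_on_torus g"
    and "\<And>x. g x \<ge> 0"
    and "\<And>x. g x = 0 \<longleftrightarrow> x = p"
    and "flow_generated_by (\<lambda>x. g x *\<^sub>R F) \<phi>"
    and "f = \<phi> 1"
  shows "sensitive f \<and> \<not> first_time_sensitive f"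
proof -
  interpret slowed_irrational_flow F g p \<phi>
    by unfold_locales (use assms in auto)
  show ?thesis
    using sensitive_time_one_map not_first_time_sensitive_time_one_map assms(6) by simp
qed

end
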